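(* Let $N$ be a positive integer, let $x\in\{-1,1\}^{\mathbb{Z}/N\mathbb{Z}}$ and $y\in\{-1,1\}^{\mathbb{Z}}$, and suppose $\Sigma(x)\neq0$. Then the cylindrical hitomezashi pattern $\mathrm{Cloth}_{\mathbb{Z}\times\mathbb{Z}/N\mathbb{Z}}(x,y)$ contains no hitomezashi loop of nonzero homology class. Further, there exists an infinite hitomezashi path in this pattern which, for each $i\in\mathbb{Z}$, contains an edge joining $(i,c_i)$ and $(i+1,c_i)$ for some $c_i\in\mathbb{Z}/N\mathbb{Z}$.
   Context: Oriented hitomezashi pattern: for $x\in\{-1,1\}^{\mathbb{Z}/N\mathbb{Z}}$, $y\in\{-1,1\}^{\mathbb{Z}}$, the pattern $\mathrm{Cloth}_{\mathbb{Z}\times\mathbb{Z}/N\mathbb{Z}}(x,y)$ is the directed graph on vertex set $\mathbb{Z}\times\mathbb{Z}/N\mathbb{Z}$ in which, for each $(i,j)$, the (horizontal) edge between $(i,j)$ and $(i+1,j)$ is oriented $(i,j)\to(i+1,j)$ if $x_j=1$ and $(i+1,j)\to(i,j)$ if $x_j=-1$, and the (vertical) edge between $(i,j)$ and $(i,j+1)$ is oriented $(i,j)\to(i,j+1)$ if $y_i=1$ and $(i,j+1)\to(i,j)$ if $y_i=-1$. A hitomezashi path is a directed path following the orientations and alternating between horizontal and vertical edges; a hitomezashi loop is a closed directed circuit following the orientations and alternating between horizontal and vertical edges. Every directed edge lies in a unique maximal such alternating trail, which is either a hitomezashi loop or an infinite hitomezashi path. The homology class of a loop $L$ is $\Delta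 y/N$, where $\Delta y$ is the number of edges of $L$ of the form $(i,j)\to(i,j+1)$ minus the number of edges of $L$ of the form $(i,j+1)\to(i,j)$. $\Sigma(x)=\sum_{i\in\mathbb{Z}/N\mathbb{Z}}x_i$. *)

theory Defs
  imports Complex_Main "Graph_Theory.Arc_Walk"
begin

text \<open>
  Residues modulo \<open>N\<close> are represented by the naturals below \<open>N\<close>, with successor \<open>Suc j mod N\<close>.
  Edges are named rather than given as vertex pairs, because the vertical edges are self-loops
  for \<open>N = 1\<close> and come in parallel pairs for \<open>N = 2\<close>: \<open>Horiz i j\<close> is the edge between
  \<open>(i, j)\<close> and \<open>(i + 1, j)\<close>, and \<open>Vert i j\<close> the edge between \<open>(i, j)\<close> and \<open>(i, j + 1)\<close>.
\<close>

datatype cloth_edge = is_Horiz: Horiz int nat | is_Vert: Vert int nat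

fun cloth_tail :: "nat \<Rightarrow> (nat \<Rightarrow> int) \<Rightarrow> (int \<Rightarrow> int) \<Rightarrow> cloth_edge \<Rightarrow> int \<times> nat" where
  "cloth_tail N x y (Horiz i j) = (if x j = 1 then (i, j) else (i + 1, j))"
| "cloth_tail N x y (Vert i j) = (if y i = 1 then (i, j) else (i, Suc j mod N))"

fun cloth_head :: "nat \<Rightarrow> (nat \<Rightarrow> int) \<Rightarrow> (int \<Rightarrow> int) \<Rightarrow> cloth_edge \<Rightarrow> int \<times> nat" where
  "cloth_head N x y (Horiz i j) = (if x j = 1 then (i + 1, j) else (i, j))"
| "cloth_head N x y (Vert i j) = (if y i = 1 then (i, Suc j mod N) else (i, j))"

definition cloth :: "nat \<Rightarrow> (nat \<Rightarrow> int) \<Rightarrow> (int \<Rightarrow> int) \<Rightarrow> (int \<times> nat, cloth_edge) pre_digraph" where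
  "cloth N x y =
     \<lparr>verts = UNIV \<times> {..<N},
      arcs = {Horiz i j | i j. j < N} \<union> {Vert i j | i j. j < N},
      tail = cloth_tail N x y,
      head = cloth_head N x y\<rparr>"

lemma wf_digraph_cloth: "wf_digraph (cloth N x y)"
  by unfold_locales (auto simp: cloth_def)

definition alternates :: "cloth_edge \<Rightarrow> cloth_edge \<Rightarrow> bool" where
  "alternates a b \<longleftrightarrow> is_Horiz a \<noteq> is_Horiz b"

text \<open>
  A loop is a closed trail: edges do not repeat, but a vertex may be visited twice (turning from
  horizontal to vertical once and from vertical to horizontal once). Alternation is required
  cyclically, that is, also between the last and the first edge.
\<close>

definition hitomezashi_loop :: "('v, cloth_edge) pre_digraph \<Rightarrow> cloth_edge list \<Rightarrow> bool" where
  "hitomezashi_loop G p \<longleftrightarrow>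
     p \<noteq> [] \<and> (\<exists>u. pre_digraph.trail G u p u) \<and>
     successively alternates p \<and> alternates (last p) (hd p)"

text \<open>
  An infinite path is a maximal alternating trail that is not a loop. As every edge has
  an alternating predecessor and an alternating successor, it is infinite in both directions.
\<close>

definition infinite_hitomezashi_path ::
    "('v, cloth_edge) pre_digraph \<Rightarrow> (int \<Rightarrow> cloth_edge) \<Rightarrow> bool" where
  "infinite_hitomezashi_path G e \<longleftrightarrow>
     (\<forall>k. e k \<in> arcs G \<and> head G (e k) = tail G (e (k + 1)) \<and> alternates (e k) (e (k + 1))) \<and>
     inj e"

definition upward :: "(int \<Rightarrow> int) \<Rightarrow> cloth_edge \<Rightarrow> bool" where
  "upward y a \<longleftrightarrow> (\<exists>i j. a = Vert i j \<and> y i = 1)"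

definition downward :: "(int \<Rightarrow> int) \<Rightarrow> cloth_edge \<Rightarrow> bool" where
  "downward y a \<longleftrightarrow> (\<exists>i j. a = Vert i j \<and> y i = - 1)"

definition delta_y :: "(int \<Rightarrow> int) \<Rightarrow> cloth_edge list \<Rightarrow> int" where
  "delta_y y p = int (length (filter (upward y) p)) - int (length (filter (downward y) p))"

definition homology_class :: "nat \<Rightarrow> (int \<Rightarrow> int) \<Rightarrow> cloth_edge list \<Rightarrow> rat" where
  "homology_class N y p = of_int (delta_y y p) / of_nat N"

end

theory Submission
  imports Defs
begin

text \<open>
  Lift the pattern to the plane and assign heights to the faces, raising the height by \<open>x j\<close> when
  row \<open>j\<close> is crossed upwards and lowering it by \<open>y i\<close> when column \<open>i\<close> is crossed rightwards. The
  height of the face to the left of the current edge is constant along an alternating path. Going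
  round a loop with vertical displacement \<open>k N\<close> changes this height by \<open>k \<Sigma>(x)\<close>, so \<open>k = 0\<close>.

  For the second claim, the net number of rightward edges that a single trail has between columns
  \<open>i\<close> and \<open>i + 1\<close> does not depend on \<open>i\<close>, since every vertical edge has exactly one predecessor and
  one successor. Summed over all trails, these fluxes give \<open>\<Sigma>(x) \<noteq> 0\<close>, so some trail has nonzero
  flux. It meets every column, hence is infinite and not a loop.
\<close>

section \<open>Sequences and orbits indexed by the integers\<close>

text \<open>Supplies the column part of the face heights. Partial sums run away from 0 in both
  directions, negated on the negative side, and one of the two ranges is always empty.\<close>

lemma ex_int_antiderivative:
  fixes y :: "int \<Rightarrow> 'a::ab_group_add"
  shows "\<exists>Y. \<forall>i. Y i = Y (i - 1) + y i"
proof -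
  define Y where "Y i = (\<Sum>k\<in>{0<..i}. y k) - (\<Sum>k\<in>{i<..0}. y k)" for i
  have "Y i = Y (i - 1) + y i" for i
  proof (cases "0 < i")
    case True
    then have "{0<..i} = insert i {0<..i - 1}" "{i<..0} = {}" "{i - 1<..0} = {}" by auto
    then show ?thesis by (simp add: Y_def)
  next
    case False
    then have "{i - 1<..0} = insert i {i<..0}" "{0<..i} = {}" "{0<..i - 1} = {}" by auto
    then show ?thesis by (simp add: Y_def)
  qed
  then show ?thesis by blast
qed

lemma ex_biinfinite_orbit:
  assumes "a \<in> A"
    and succ: "\<And>a. a \<in> A \<Longrightarrow> \<exists>b\<in>A. R a b"
    and pred: "\<And>b. b \<in> A \<Longrightarrow> \<exists>a\<in>A. R a b"
  shows "\<exists>e :: int \<Rightarrow> 'a. e 0 = a \<and> (\<forall>k. R (e k) (e (k + 1)))"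
proof -
  obtain f where f: "\<And>a. a \<in> A \<Longrightarrow> f a \<in> A \<and> R a (f a)" using succ by metis
  obtain g where g: "\<And>b. b \<in> A \<Longrightarrow> g b \<in> A \<and> R (g b) b" using pred by metis
  have fA: "(f ^^ n) a \<in> A" for n using f \<open>a \<in> A\<close> by (induction n) auto
  have gA: "(g ^^ n) a \<in> A" for n using g \<open>a \<in> A\<close> by (induction n) auto
  define e where "e k = (if 0 \<le> k then (f ^^ nat k) a else (g ^^ nat (- k)) a)" for k :: int
  have "R (e k) (e (k + 1))" for k
  proof (cases "0 \<le> k")
    case True
    then have "e (k + 1) = f (e k)" by (simp add: e_def nat_add_distrib)
    then show ?thesis using f fA True by (simp add: e_def)
  next
    case False
    then have "nat (- k) = Suc (nat (- (k + 1)))" by simp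
    \<comment> \<open>At \<open>k = -1\<close> the backward half meets the forward half in
      \<open>a\<close>.\<close>
    then have "e k = g (e (k + 1))" using False by (cases "k = -1") (auto simp: e_def)
    moreover have "e (k + 1) \<in> A" using fA gA by (simp add: e_def)
    ultimately show ?thesis using g by simp
  qed
  moreover have "e 0 = a" by (simp add: e_def)
  ultimately show ?thesis by blast
qed

text \<open>A single repetition spreads in both directions by uniqueness of successors and
  predecessors, so \<open>e\<close> would be periodic and its range finite.\<close>

lemma inj_biinfinite_orbit:
  fixes e :: "int \<Rightarrow> 'a"
  assumes e: "\<And>k. R (e k) (e (k + 1))"
    and "left_unique R" "right_unique R" and "infinite (range e)"
  shows "inj e"
proof (rule ccontr)
  assume "\<not> inj e"
  then obtain k l where kl: "e k = e l" "k < l"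
    by (metis injI linorder_neqE)
  define d where "d = l - k"
  have d: "d > 0" using kl by (simp add: d_def)
  have period: "e m = e (m + d)" for m
  proof (induction m rule: int_induct[where k = k])
    case base
    then show ?case using kl by (simp add: d_def)
  next
    case (step1 i)
    have "R (e i) (e (i + d + 1))" using step1 e[of "i + d"] by simp
    with e[of i] \<open>right_unique R\<close> have "e (i + 1) = e (i + d + 1)" by (auto dest: right_uniqueD)
    then show ?case by (simp add: algebra_simps)
  next
    case (step2 i)
    have "R (e (i + d - 1)) (e i)" using step2 e[of "i + d - 1"] by simp
    with e[of "i - 1"] \<open>left_unique R\<close> have "e (i - 1) = e (i + d - 1)" by (auto dest: left_uniqueD)
    then show ?case by (simp add: algebra_simps)
  qed
  have multiple: "e m = e (m + t * d)" for m t
  proof (induction t rule: int_induct[where k = 0])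
    case base
    show ?case by simp
  next
    case (step1 t)
    then show ?case using period[of "m + t * d"] by (simp add: algebra_simps)
  next
    case (step2 t)
    then show ?case using period[of "m + (t - 1) * d"] by (simp add: algebra_simps)
  qed
  have "e m \<in> e ` {0..<d}" for m
  proof -
    have "e m = e (m mod d)"
      using multiple[of "m mod d" "m div d"] by (simp add: mod_mult_div_eq mult.commute)
    then show ?thesis using d by simp
  qed
  then have "range e \<subseteq> e ` {0..<d}" by blast
  then show False using \<open>infinite (range e)\<close> finite_subset by blast
qed

lemma bij_betw_Suc_mod: "bij_betw (\<lambda>j. Suc j mod N) {..<N} {..<N}"
proof (cases "N = 0")
  case False
  have "inj_on (\<lambda>j. Suc j mod N) {..<N}"
    by (auto simp: inj_on_def mod_Suc split: if_splits)
  moreover from this False have "(\<lambda>j. Suc j mod N) ` {..<N} = {..<N}"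
    by (intro endo_inj_surj) auto
  ultimately show ?thesis by (simp add: bij_betw_def)
qed (simp add: bij_betw_def)

lemma delta_y_Nil [simp]: "delta_y y [] = 0"
  by (simp add: delta_y_def)

lemma delta_y_Cons:
  "delta_y y (a # p) = (if upward y a then 1 else 0) - (if downward y a then 1 else 0) + delta_y y p"
  by (simp add: delta_y_def)

section \<open>Successors and predecessors of edges\<close>

locale cylindrical_pattern =
  fixes N :: nat and x :: "nat \<Rightarrow> int" and y :: "int \<Rightarrow> int"
  assumes N_pos: "N > 0"
    and x_cases: "j < N \<Longrightarrow> x j = -1 \<or> x j = 1"
    and y_cases: "y i = -1 \<or> y i = 1"
begin

abbreviation G where "G \<equiv> cloth N x y"

definition next_edge :: "cloth_edge \<Rightarrow> cloth_edge \<Rightarrow> bool" where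
  "next_edge a b \<longleftrightarrow> a \<in> arcs G \<and> b \<in> arcs G \<and> head G a = tail G b \<and> alternates a b"

lemma arcs_simps [simp]: "Horiz i j \<in> arcs G \<longleftrightarrow> j < N" "Vert i j \<in> arcs G \<longleftrightarrow> j < N"
  by (auto simp: cloth_def)

lemma tail_head_simps [simp]: "tail G = cloth_tail N x y" "head G = cloth_head N x y"
  by (simp_all add: cloth_def)

lemma next_edge_simps [simp]:
  "\<not> next_edge (Horiz i j) (Horiz i' j')"
  "\<not> next_edge (Vert i j) (Vert i' j')"
  by (simp_all add: next_edge_def alternates_def)

lemma next_edge_Horiz_Vert:
  "next_edge (Horiz i j) (Vert i' j') \<longleftrightarrow>
     j < N \<and> j' < N \<and> (if x j = 1 then i + 1 else i) = i' \<and>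
     (if y i' = 1 then j' else Suc j' mod N) = j"
  by (auto simp: next_edge_def alternates_def)

lemma next_edge_Vert_Horiz:
  "next_edge (Vert i j) (Horiz i' j') \<longleftrightarrow>
     j < N \<and> j' < N \<and> (if x j' = 1 then i' else i' + 1) = i \<and>
     (if y i = 1 then Suc j mod N else j) = j'"
  by (auto simp: next_edge_def alternates_def)

lemma Suc_mod_inj: "j < N \<Longrightarrow> j' < N \<Longrightarrow> Suc j mod N = Suc j' mod N \<Longrightarrow> j = j'"
  using bij_betw_imp_inj_on[OF bij_betw_Suc_mod[of N]] by (meson inj_onD lessThan_iff)

lemma Suc_mod_surj: "j < N \<Longrightarrow> \<exists>j'<N. j = Suc j' mod N"
  using bij_betw_imp_surj_on[OF bij_betw_Suc_mod[of N]] by blast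

text \<open>All edges of a row point the same way, and so do all edges of a column; hence exactly
  one edge of each kind enters a vertex and exactly one leaves it.\<close>

lemma right_unique_next_edge: "right_unique next_edge"
proof (rule right_uniqueI)
  fix a b c assume "next_edge a b" "next_edge a c"
  then show "b = c"
    by (cases a; cases b; cases c)
       (auto simp: next_edge_Horiz_Vert next_edge_Vert_Horiz split: if_splits dest: Suc_mod_inj)
qed

lemma left_unique_next_edge: "left_unique next_edge"
proof (rule left_uniqueI)
  fix a b c assume "next_edge a c" "next_edge b c"
  then show "a = b"
    by (cases a; cases b; cases c)
       (auto simp: next_edge_Horiz_Vert next_edge_Vert_Horiz split: if_splits dest: Suc_mod_inj)
qed

lemma ex_next_edge:
  assumes "a \<in> arcs G"
  shows "\<exists>b\<in>arcs G. next_edge a b"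
proof (cases a)
  case (Horiz i j)
  then have "j < N" using assms by simp
  define i' where "i' = (if x j = 1 then i + 1 else i)"
  obtain j' where "j' < N" "j = (if y i' = 1 then j' else Suc j' mod N)"
    using Suc_mod_surj[OF \<open>j < N\<close>] \<open>j < N\<close> by (cases "y i' = 1") auto
  then have "next_edge a (Vert i' j')"
    using Horiz \<open>j < N\<close> by (simp add: next_edge_Horiz_Vert i'_def)
  then show ?thesis using \<open>j' < N\<close> by (intro bexI[of _ "Vert i' j'"]) auto
next
  case (Vert i j)
  then have "j < N" using assms by simp
  define j' where "j' = (if y i = 1 then Suc j mod N else j)"
  \<comment> \<open>A leftward edge starting in column \<open>i\<close> is named after its left end,
    column \<open>i - 1\<close>.\<close>
  define i' where "i' = (if x j' = 1 then i else i - 1)"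
  have "j' < N" using \<open>j < N\<close> by (simp add: j'_def)
  then have "next_edge a (Horiz i' j')"
    using Vert \<open>j < N\<close> by (auto simp: next_edge_Vert_Horiz i'_def) (auto simp: j'_def)
  then show ?thesis using \<open>j' < N\<close> by (intro bexI[of _ "Horiz i' j'"]) auto
qed

lemma ex_prev_edge:
  assumes "b \<in> arcs G"
  shows "\<exists>a\<in>arcs G. next_edge a b"
proof (cases b)
  case (Horiz i j)
  then have "j < N" using assms by simp
  define i' where "i' = (if x j = 1 then i else i + 1)"
  obtain j' where "j' < N" "j = (if y i' = 1 then Suc j' mod N else j')"
    using Suc_mod_surj[OF \<open>j < N\<close>] \<open>j < N\<close> by (cases "y i' = 1") auto
  then have "next_edge (Vert i' j') b"
    using Horiz \<open>j < N\<close> by (simp add: next_edge_Vert_Horiz i'_def)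
  then show ?thesis using \<open>j' < N\<close> by (intro bexI[of _ "Vert i' j'"]) auto
next
  case (Vert i j)
  then have "j < N" using assms by simp
  define j' where "j' = (if y i = 1 then j else Suc j mod N)"
  define i' where "i' = (if x j' = 1 then i - 1 else i)"
  have "j' < N" using \<open>j < N\<close> by (simp add: j'_def)
  then have "next_edge (Horiz i' j') b"
    using Vert \<open>j < N\<close> by (auto simp: next_edge_Horiz_Vert i'_def) (auto simp: j'_def)
  then show ?thesis using \<open>j' < N\<close> by (intro bexI[of _ "Horiz i' j'"]) auto
qed

subsection \<open>Loops\<close>

text \<open>Removing the mean slope makes the partial sums of \<open>x\<close> periodic modulo
  \<open>N\<close>; the factor \<open>N\<close> keeps the values integral.\<close>

definition row_height :: "nat \<Rightarrow> int" where
  "row_height j = int N * (\<Sum>k<j. x k) - (\<Sum>k<N. x k) * int j"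

lemma row_height_Suc: "row_height (Suc j) = row_height j + int N * x j - (\<Sum>k<N. x k)"
  by (simp add: row_height_def algebra_simps)

lemma row_height_Suc_mod: "j < N \<Longrightarrow> row_height (Suc j mod N) = row_height (Suc j)"
  \<comment> \<open>At the seam, the values at \<open>N\<close> and at 0 are both 0.\<close>
  by (cases "Suc j = N") (auto simp: row_height_def)

text \<open>
  \<open>N\<close> times the height of the face to the left of the edge, minus \<open>\<Sigma>(x)\<close> times the row of its tail;
  the correction makes it well defined on the cylinder.
\<close>

fun left_height :: "(int \<Rightarrow> int) \<Rightarrow> cloth_edge \<Rightarrow> int" where
  "left_height Y (Horiz i j) = row_height j + (if x j = 1 then int N else 0) - int N * Y i"
| "left_height Y (Vert i j) =
     row_height (Suc j) + (if y i = 1 then (\<Sum>k<N. x k) - int N * Y (i - 1) else - int N * Y i)"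

text \<open>A left turn keeps the same face on the left. A right turn passes to the diagonally
  opposite face, and the changes from crossing the row and the column cancel. What remains is the
  change of the correction term with the row of the tail.\<close>

lemma left_height_next_edge:
  assumes Y: "\<And>i. Y i = Y (i - 1) + y i" and "next_edge a b"
  shows "left_height Y b = left_height Y a - (\<Sum>k<N. x k) * delta_y y [a]"
proof (cases a)
  case (Horiz i j)
  then obtain i' j' where b: "b = Vert i' j'" using assms(2) by (cases b) auto
  have N: "j < N" "j' < N"
    and i': "x j = 1 \<and> i' = i + 1 \<or> x j = -1 \<and> i' = i"
    and j: "y i' = 1 \<and> j = j' \<or> y i' = -1 \<and> j = Suc j' mod N"
    using assms(2) x_cases[of j] y_cases[of i']
    by (auto simp: Horiz b next_edge_Horiz_Vert split: if_splits)
  have d: "delta_y y [Horiz k l] = 0" for k l by (simp add: delta_y_Cons upward_def downward_def)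
  have NY: "int N * Y i' = int N * Y (i' - 1) + int N * y i'"
    by (subst Y) (simp add: distrib_left)
  show ?thesis
    using i' j
    by (elim disjE conjE)
       (use N NY in \<open>simp_all add: Horiz b d row_height_Suc_mod row_height_Suc algebra_simps\<close>)
next
  case (Vert i j)
  then obtain i' j' where b: "b = Horiz i' j'" using assms(2) by (cases b) auto
  have N: "j < N" "j' < N"
    and i: "x j' = 1 \<and> i = i' \<or> x j' = -1 \<and> i = i' + 1"
    and j': "y i = 1 \<and> j' = Suc j mod N \<or> y i = -1 \<and> j' = j"
    using assms(2) x_cases[of j'] y_cases[of i]
    by (auto simp: Vert b next_edge_Vert_Horiz split: if_splits)
  have d: "delta_y y [Vert k l] = y k" for k l
    using y_cases[of k] by (auto simp: delta_y_Cons upward_def downward_def)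
  have NY: "int N * Y i = int N * Y (i - 1) + int N * y i"
    by (subst Y) (simp add: distrib_left)
  show ?thesis
    using i j'
    by (elim disjE conjE)
       (use N NY in \<open>simp_all add: Vert b d row_height_Suc_mod row_height_Suc algebra_simps\<close>)
qed

text \<open>The one-step changes telescope. The final edge \<open>b\<close> is kept apart from
  \<open>p\<close> so that it can be the first edge of a loop again.\<close>

lemma left_height_walk:
  assumes Y: "\<And>i. Y i = Y (i - 1) + y i"
    and "pre_digraph.cas G u p (tail G b)" "successively alternates (p @ [b])"
      "set (p @ [b]) \<subseteq> arcs G"
  shows "left_height Y b = left_height Y (hd (p @ [b])) - (\<Sum>k<N. x k) * delta_y y p"
  using assms(2-)
proof (induction p arbitrary: u)
  case (Cons a p)
  let ?c = "hd (p @ [b])"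
  have cas: "pre_digraph.cas G (head G a) p (tail G b)"
    using Cons.prems by (simp add: pre_digraph.cas.simps)
  have "head G a = tail G ?c"
    using cas by (cases p) (simp_all add: pre_digraph.cas.simps)
  moreover have "alternates a ?c" "?c \<in> arcs G"
    using Cons.prems by (cases p; simp)+
  ultimately have "next_edge a ?c" using Cons.prems by (simp add: next_edge_def)
  from left_height_next_edge[OF Y this]
  have "left_height Y ?c = left_height Y a - (\<Sum>k<N. x k) * delta_y y [a]" .
  moreover have "left_height Y b = left_height Y ?c - (\<Sum>k<N. x k) * delta_y y p"
    using Cons.IH[OF cas] Cons.prems by (cases p) auto
  ultimately show ?case by (simp add: delta_y_Cons algebra_simps)
qed simp

lemma sum_times_delta_y_loop:
  assumes "hitomezashi_loop G p"
  shows "(\<Sum>k<N. x k) * delta_y y p = 0"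
proof -
  obtain Y where Y: "\<And>i. Y i = Y (i - 1) + y i" using ex_int_antiderivative by blast
  obtain u where u: "pre_digraph.cas G u p u" "set p \<subseteq> arcs G" and "p \<noteq> []"
    using assms by (auto simp: hitomezashi_loop_def pre_digraph.trail_def pre_digraph.awalk_def)
  then have "u = tail G (hd p)" by (cases p) (auto simp: pre_digraph.cas.simps)
  moreover have "successively alternates (p @ [hd p])"
    using assms by (auto simp: hitomezashi_loop_def successively_append_iff)
  \<comment> \<open>With \<open>b = hd p\<close> the two heights coincide, so the accumulated change
    is 0.\<close>
  ultimately show ?thesis
    using left_height_walk[OF Y, of u p "hd p"] u \<open>p \<noteq> []\<close> by (simp add: subset_iff)
qed

subsection \<open>Flux\<close>

definition flux :: "cloth_edge set \<Rightarrow> int \<Rightarrow> int" where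
  "flux S i = (\<Sum>j | j < N \<and> Horiz i j \<in> S. x j)"

text \<open>Each vertical edge of column \<open>i\<close> in \<open>S\<close> links the horizontal
  edge of \<open>S\<close> entering its tail to the one leaving its head, so as many edges of
  \<open>S\<close> enter the column as leave it.\<close>

lemma flux_step:
  assumes S: "\<And>a b. next_edge a b \<Longrightarrow> a \<in> S \<longleftrightarrow> b \<in> S"
  shows "flux S (i - 1) = flux S i"
proof -
  define In where "In = {j. j < N \<and> (if x j = 1 then Horiz (i - 1) j else Horiz i j) \<in> S}"
  define Out where "Out = {j. j < N \<and> (if x j = 1 then Horiz i j else Horiz (i - 1) j) \<in> S}"
  let ?s = "\<lambda>j. Suc j mod N"
  have inj: "inj_on ?s M" if "M \<subseteq> {..<N}" for M
    using bij_betw_Suc_mod[of N] that by (meson bij_betw_def inj_on_subset)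
  have sub: "In \<subseteq> {..<N}" "Out \<subseteq> {..<N}" by (auto simp: In_def Out_def)
  have card: "card In = card Out"
  proof (cases "y i = 1")
    case True
    \<comment> \<open>In an upward column \<open>Vert i j\<close> leads from row \<open>j\<close> to
      the next row, so \<open>Out\<close> is \<open>In\<close> shifted by one.\<close>
    have "j \<in> In \<longleftrightarrow> ?s j \<in> Out" if "j < N" for j
    proof -
      have "j \<in> In \<longleftrightarrow> Vert i j \<in> S"
        using S[of "Horiz (i - 1) j" "Vert i j"] S[of "Horiz i j" "Vert i j"] that True
        by (auto simp: In_def next_edge_Horiz_Vert)
      also have "\<dots> \<longleftrightarrow> ?s j \<in> Out"
        using S[of "Vert i j" "Horiz (i - 1) (?s j)"] S[of "Vert i j" "Horiz i (?s j)"] that True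
        by (auto simp: Out_def next_edge_Vert_Horiz)
      finally show ?thesis .
    qed
    then have "Out = ?s ` In" using sub Suc_mod_surj by (force simp: image_iff)
    then show ?thesis using card_image inj sub by metis
  next
    case False
    \<comment> \<open>In a downward column \<open>Vert i j\<close> ends in row \<open>j\<close>, so
      \<open>In\<close> and \<open>Out\<close> trade places.\<close>
    have "j \<in> Out \<longleftrightarrow> ?s j \<in> In" if "j < N" for j
    proof -
      have "j \<in> Out \<longleftrightarrow> Vert i j \<in> S"
        using S[of "Vert i j" "Horiz (i - 1) j"] S[of "Vert i j" "Horiz i j"] that False
        by (auto simp: Out_def next_edge_Vert_Horiz)
      also have "\<dots> \<longleftrightarrow> ?s j \<in> In"
        using S[of "Horiz (i - 1) (?s j)" "Vert i j"] S[of "Horiz i (?s j)" "Vert i j"] that False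
        by (auto simp: In_def next_edge_Horiz_Vert)
      finally show ?thesis .
    qed
    then have "In = ?s ` Out" using sub Suc_mod_surj by (force simp: image_iff)
    then show ?thesis using card_image inj sub by metis
  qed
  have flux: "flux S k = (\<Sum>j<N. if Horiz k j \<in> S then x j else 0)" for k
    by (auto simp: flux_def sum.If_cases intro!: sum.cong)
  have "int (card In) = (\<Sum>j<N. of_bool (j \<in> In))" "int (card Out) = (\<Sum>j<N. of_bool (j \<in> Out))"
    using sub by (simp_all add: Int_absorb1)
  then have "int (card Out) - int (card In) = (\<Sum>j<N. of_bool (j \<in> Out) - of_bool (j \<in> In))"
    by (simp add: sum_subtractf)
  \<comment> \<open>In a leftward row the incoming and outgoing edges are swapped, and the sign
    \<open>x j = -1\<close> compensates for this.\<close>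
  also have "\<dots> = (\<Sum>j<N. (if Horiz i j \<in> S then x j else 0) -
      (if Horiz (i - 1) j \<in> S then x j else 0))"
  proof (rule sum.cong)
    fix j assume "j \<in> {..<N}"
    then show "(of_bool (j \<in> Out) - of_bool (j \<in> In) :: int) =
        (if Horiz i j \<in> S then x j else 0) - (if Horiz (i - 1) j \<in> S then x j else 0)"
      using x_cases[of j] by (auto simp: In_def Out_def)
  qed simp
  also have "\<dots> = flux S i - flux S (i - 1)"
    by (simp add: flux sum_subtractf)
  finally show ?thesis using card by simp
qed

lemma flux_eq_flux_0:
  assumes "\<And>a b. next_edge a b \<Longrightarrow> a \<in> S \<longleftrightarrow> b \<in> S"
  shows "flux S i = flux S 0"
proof (induction i rule: int_induct[where k = 0])
  case (step1 i)
  then show ?case using flux_step[OF assms, of "i + 1"] by simp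
next
  case (step2 i)
  then show ?case using flux_step[OF assms, of i] by simp
qed simp

text \<open>For an arc \<open>a\<close>, the edge set of the maximal alternating trail through
  \<open>a\<close>, be it a loop or an infinite path.\<close>

definition edge_class :: "cloth_edge \<Rightarrow> cloth_edge set" where
  "edge_class a = {b. equivclp next_edge a b}"

lemma edge_class_eq: "b \<in> edge_class a \<longleftrightarrow> edge_class b = edge_class a"
  unfolding edge_class_def by (auto intro: equivclp_trans equivclp_sym)

lemma edge_class_next_edge: "next_edge b c \<Longrightarrow> b \<in> edge_class a \<longleftrightarrow> c \<in> edge_class a"
  unfolding edge_class_def
  by (metis mem_Collect_eq equivclp_trans equivclp_sym r_into_equivclp)

text \<open>The trails partition the edges between columns 0 and 1, so their fluxes there add up to
  the sum of \<open>x\<close>.\<close>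

lemma ex_class_with_flux:
  assumes "(\<Sum>j<N. x j) \<noteq> 0"
  shows "\<exists>j<N. flux (edge_class (Horiz 0 j)) 0 \<noteq> 0"
proof (rule ccontr)
  assume *: "\<not> ?thesis"
  let ?cl = "\<lambda>j. edge_class (Horiz 0 j)"
  have "(\<Sum>j<N. x j) = (\<Sum>S\<in>?cl ` {..<N}. \<Sum>j | j \<in> {..<N} \<and> ?cl j = S. x j)"
    by (rule sum.image_gen) simp
  also have "\<dots> = (\<Sum>S\<in>?cl ` {..<N}. flux S 0)"
    by (intro sum.cong refl) (auto simp: flux_def edge_class_eq)
  also have "\<dots> = 0" using * by (intro sum.neutral) auto
  finally show False using assms by simp
qed

text \<open>By uniqueness of successors and predecessors, no step in either direction leaves the
  orbit.\<close>

lemma edge_class_subset_orbit: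
  assumes e: "\<And>k. next_edge (e k) (e (k + 1))"
  shows "edge_class (e 0) \<subseteq> range (e :: int \<Rightarrow> cloth_edge)"
proof
  fix b assume "b \<in> edge_class (e 0)"
  then have "equivclp next_edge (e 0) b" by (simp add: edge_class_def)
  then show "b \<in> range e"
  proof (induction rule: equivclp_induct)
    case (step c d)
    then obtain k where k: "c = e k" by blast
    from step(2) show ?case
    proof
      assume "next_edge c d"
      then have "d = e (k + 1)" using e[of k] k right_unique_next_edge by (auto dest: right_uniqueD)
      then show ?case by blast
    next
      assume "next_edge d c"
      then have "d = e (k - 1)"
        using e[of "k - 1"] k left_unique_next_edge by (auto dest: left_uniqueD)
      then show ?case by blast
    qed
  qed simp
qed

lemma ex_path_through_all_columns:
  assumes "(\<Sum>j<N. x j) \<noteq> 0"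
  shows "\<exists>e. infinite_hitomezashi_path G e \<and> (\<forall>i. \<exists>c<N. Horiz i c \<in> range e)"
proof -
  obtain j where j: "j < N" "flux (edge_class (Horiz 0 j)) 0 \<noteq> 0"
    using ex_class_with_flux[OF assms] by blast
  obtain e :: "int \<Rightarrow> cloth_edge"
    where e0: "e 0 = Horiz 0 j" and e: "\<And>k. next_edge (e k) (e (k + 1))"
    using ex_biinfinite_orbit[of "Horiz 0 j" "arcs G" next_edge] ex_next_edge ex_prev_edge j(1)
    by auto
  have cols: "\<exists>c<N. Horiz i c \<in> range e" for i
  proof -
    have "flux (edge_class (e 0)) i \<noteq> 0"
      using flux_eq_flux_0[OF edge_class_next_edge] j(2) e0 by metis
    then have "\<exists>c<N. Horiz i c \<in> edge_class (e 0)"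
      unfolding flux_def by (metis (mono_tags, lifting) mem_Collect_eq sum.neutral)
    then show ?thesis using edge_class_subset_orbit[of e, OF e] by blast
  qed
  then obtain c where c: "\<And>i. Horiz i (c i) \<in> range e" by metis
  \<comment> \<open>One edge from each column gap gives infinitely many distinct edges, so the orbit
    cannot close up.\<close>
  have "inj (\<lambda>i. Horiz i (c i))" by (auto simp: inj_on_def)
  then have "infinite (range (\<lambda>i. Horiz i (c i)))" using finite_imageD infinite_UNIV_int by blast
  moreover have "range (\<lambda>i. Horiz i (c i)) \<subseteq> range e" using c by blast
  ultimately have "infinite (range e)" using finite_subset by blast
  then have "inj e"
    using inj_biinfinite_orbit[of next_edge e, OF e left_unique_next_edge right_unique_next_edge] by blast
  then have "infinite_hitomezashi_path G e"
    using e by (auto simp: infinite_hitomezashi_path_def next_edge_def)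
  then show ?thesis using cols by blast
qed

end

theorem theorem1p2:
  fixes N :: nat and x :: "nat \<Rightarrow> int" and y :: "int \<Rightarrow> int"
  assumes "N > 0"
    and "\<And>j. j < N \<Longrightarrow> x j \<in> {-1, 1}"
    and "\<And>i. y i \<in> {-1, 1}"
    and "(\<Sum>j<N. x j) \<noteq> 0"
  shows "\<not> (\<exists>p. hitomezashi_loop (cloth N x y) p \<and> homology_class N y p \<noteq> 0) \<and>
         (\<exists>e. infinite_hitomezashi_path (cloth N x y) e \<and>
              (\<forall>i. \<exists>c<N. Horiz i c \<in> range e))"
proof -
  interpret cylindrical_pattern N x y
    using assms(1-3) by unfold_locales auto
  show ?thesis
    using sum_times_delta_y_loop ex_path_through_all_columns assms(4)
    by (auto simp: homology_class_def)
qed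

end
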